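(* Let $L$ be a field of characteristic $p$, let $\alpha_1,\alpha_2,\beta\in L$ with $\alpha_1\neq\alpha_2$, and let $d=p^\ell$ for some $\ell\in\mathbb{N}$. For $\lambda\in\overline{L}$ let $f_\lambda(z)=z^d+\lambda$, and let $$C(\alpha_1,\alpha_2;\beta)=\{\lambda\in\overline{L}:\ \text{there exist } m,n\in\mathbb{N} \text{ with } f_\lambda^m(\alpha_1)=f_\lambda^n(\alpha_2)=\beta\}.$$ Let $\delta_1:=\alpha_2-\alpha_1$ and $\delta_2:=\beta-\alpha_1$, and assume there is a finite subfield $\mathbb{F}_q\subseteq L$ with $\delta_1\in\mathbb{F}_q^\ast$ and $\delta_2\in\mathbb{F}_q$. Then $C(\alpha_1,\alpha_2;\beta)$ is infinite if the system $$\delta_1=\sum_{i=0}^{s_1-1}\gamma^{p^{ik\ell}},\qquad \delta_2=\sum_{i=0}^{s_2-1}\gamma^{p^{ik\ell}}$$ has a solution $(\gamma,k,s_1,s_2)\in\mathbb{F}_q^\ast\times\mathbb{N}\times\mathbb{N}\times\mathbb{N}$; and $C(\alpha_1,\alpha_2;\beta)$ is empty if this system has no such solution.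
   Context: $\mathbb{N}$ denotes the set of positive integers. $\overline{L}$ is a fixed algebraic closure of $L$. $f_\lambda^n$ denotes the $n$-th compositional iterate of $f_\lambda$. *)

theory Defs
  imports "HOL-Algebra.Algebraic_Closure_Type"
begin

definition unicrit :: "nat \<Rightarrow> 'a::comm_semiring_1 \<Rightarrow> 'a \<Rightarrow> 'a" where
  "unicrit d lam z = z ^ d + lam"

definition collision_set ::
    "nat \<Rightarrow> 'a::field \<Rightarrow> 'a \<Rightarrow> 'a \<Rightarrow> 'a alg_closure set" where
  "collision_set d \<alpha>\<^sub>1 \<alpha>\<^sub>2 \<beta> =
    {lam. \<exists>m n. m > 0 \<and> n > 0 \<and>
      (unicrit d lam ^^ m) (to_ac \<alpha>\<^sub>1) = to_ac \<beta> \<and>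
      (unicrit d lam ^^ n) (to_ac \<alpha>\<^sub>2) = to_ac \<beta>}"

definition system_solution ::
    "nat \<Rightarrow> nat \<Rightarrow> 'a::field set \<Rightarrow> 'a \<Rightarrow> 'a \<Rightarrow> 'a \<Rightarrow> nat \<Rightarrow> nat \<Rightarrow> nat \<Rightarrow> bool" where
  "system_solution p l F \<delta>\<^sub>1 \<delta>\<^sub>2 \<gamma> k s\<^sub>1 s\<^sub>2 \<longleftrightarrow>
    \<gamma> \<in> F - {0} \<and> k > 0 \<and> s\<^sub>1 > 0 \<and> s\<^sub>2 > 0 \<and>
    \<delta>\<^sub>1 = (\<Sum>i = 0..s\<^sub>1 - 1. \<gamma> ^ (p ^ (i * k * l))) \<and>
    \<delta>\<^sub>2 = (\<Sum>i = 0..s\<^sub>2 - 1. \<gamma> ^ (p ^ (i * k * l)))"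

end

theory Submission
  imports Defs
begin

text \<open>
  As \<open>z \<mapsto> z ^ d\<close> is additive, the iterates of \<open>f z = z ^ d + c\<close> satisfy
  \<open>f\<^sup>n z = z ^ d\<^sup>n + f\<^sup>n 0\<close>, and a translation moves \<open>\<alpha>\<^sub>1\<close> to \<open>0\<close>. The times \<open>n\<close>
  at which the orbit of \<open>0\<close> visits the finite field \<open>F\<close> are the multiples of the least positive
  one \<open>k\<close>, and the visited points are the sums in the system with \<open>\<gamma> = f\<^sup>k 0\<close>. Since
  \<open>f\<^sup>k\<close> permutes \<open>F\<close>, the point \<open>0\<close> is periodic, so a collision means that \<open>\<delta>\<^sub>1\<close> and \<open>\<delta>\<^sub>2\<close>
  are both visited. Conversely, in a solution \<open>k\<close> may be increased by multiples of a Frobenius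
  period of \<open>\<gamma>\<close>, and \<open>f\<^sup>k 0 = \<gamma>\<close> is a separable equation of degree \<open>d ^ (k - 1)\<close> in \<open>c\<close>.
\<close>

section \<open>Counting the roots of separable polynomials\<close>

lemma card_roots_separable:
  fixes P :: "'b::alg_closed_field poly"
  assumes "P \<noteq> 0" and sep: "\<And>a. poly P a = 0 \<Longrightarrow> poly (pderiv P) a \<noteq> 0"
  shows "card {x. poly P x = 0} = degree P"
proof -
  obtain A where A: "size A = degree P"
    and P: "P = smult (lead_coeff P) (\<Prod>x\<in>#A. [:-x, 1:])"
    using alg_closed_imp_factorization[OF \<open>P \<noteq> 0\<close>] by blast
  define c where "c = lead_coeff P"
  have c: "c \<noteq> 0" using assms(1) by (simp add: c_def)
  have P': "P = smult c (\<Prod>x\<in>#A. [:-x, 1:])" using P by (simp add: c_def)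
  have roots: "{x. poly P x = 0} = set_mset A"
    using c by (auto simp: P' poly_prod_mset)
  have "count A a \<le> 1" for a
  proof (rule ccontr)
    assume "\<not> count A a \<le> 1"
    \<comment> \<open>A repeated entry splits off the square of \<open>[:-a, 1:]\<close>, which
      makes \<open>a\<close> a common root of \<open>P\<close> and \<open>pderiv P\<close>.\<close>
    then have "{#a, a#} \<subseteq># A"
      by (auto simp: subseteq_mset_def)
    then obtain B where B: "A = {#a, a#} + B"
      by (metis subset_mset.add_diff_inverse)
    define Q where "Q = smult c (\<Prod>x\<in>#B. [:-x, 1:])"
    have Q: "P = [:-a, 1:] * ([:-a, 1:] * Q)"
      unfolding P' B Q_def by (simp add: mult.assoc)
    have "poly P a = 0" "poly (pderiv P) a = 0"
      unfolding Q pderiv_mult by simp_all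
    then show False using sep by blast
  qed
  then have "A = mset_set (set_mset A)"
    by (intro multiset_eqI) (metis count_mset_set(1) count_mset_set(3) finite_set_mset
        not_in_iff le_antisym count_greater_eq_one_iff)
  then have "size A = card (set_mset A)"
    by (metis size_mset_set)
  then show ?thesis using A roots by simp
qed

section \<open>Iterates of z^d + c when d is a power of the characteristic\<close>

locale frobenius_power =
  fixes d l :: nat and ty :: "'b::field itself"
  assumes char_prime: "prime CHAR('b)"
    and d_eq: "d = CHAR('b) ^ l"
    and l_pos: "l > 0"
begin

lemma d_gt_1: "d > 1"
  unfolding d_eq using one_less_power[OF prime_gt_1_nat[OF char_prime] l_pos] .

lemma frob_add: "(x + y :: 'b) ^ (d ^ n) = x ^ (d ^ n) + y ^ (d ^ n)"
  by (rule freshmans_dream'[OF char_prime, of _ "l * n"]) (simp add: d_eq power_mult)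

lemma frob_diff: "(x - y :: 'b) ^ (d ^ n) = x ^ (d ^ n) - y ^ (d ^ n)"
  using frob_add[of "x - y" y n] by (simp add: algebra_simps)

lemma funpow_Suc_unicrit: "(unicrit d c ^^ Suc n) z = ((unicrit d c ^^ n) z) ^ d + c"
  by (simp add: unicrit_def)

lemma funpow_unicrit:
  "(unicrit d c ^^ n) (z :: 'b) = z ^ (d ^ n) + (unicrit d c ^^ n) 0"
proof (induction n)
  case (Suc n)
  have "(unicrit d c ^^ Suc n) z = (z ^ (d ^ n) + (unicrit d c ^^ n) 0) ^ d + c"
    by (simp only: funpow_Suc_unicrit Suc)
  also have "\<dots> = z ^ (d ^ Suc n) + (((unicrit d c ^^ n) 0) ^ d + c)"
    using frob_add[of _ _ 1] by (simp add: mult.commute flip: power_mult)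
  finally show ?case by (simp only: funpow_Suc_unicrit)
qed simp

text \<open>Since (z - a)^d = z^d - a^d, translation by \<open>a\<close> conjugates one unicritical
  map to another and only shifts the parameter. It serves to move the first starting point to
  0.\<close>

lemma funpow_unicrit_conj:
  "(unicrit d c ^^ n) (z :: 'b) = (unicrit d (c + a ^ d - a) ^^ n) (z - a) + a"
proof (induction n)
  case (Suc n)
  then show ?case
    using frob_add[of _ a 1] by (simp add: unicrit_def)
qed simp

lemma inj_unicrit: "inj (unicrit d (c :: 'b))"
proof (rule injI)
  fix x y :: 'b
  assume "unicrit d c x = unicrit d c y"
  then have "(x - y) ^ d = 0"
    using frob_diff[of x y 1] by (simp add: unicrit_def)
  then show "x = y" by simp
qed

text \<open>By \<open>funpow_unicrit\<close>, each further block of \<open>k\<close> iterations adds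
  one more Frobenius power of the \<open>k\<close>-th iterate of 0; this is how the sums of the
  system arise.\<close>

lemma funpow_unicrit_mult:
  "(unicrit d c ^^ (k * s)) (0 :: 'b) = (\<Sum>i<s. ((unicrit d c ^^ k) 0) ^ (d ^ (k * i)))"
proof (induction s)
  case (Suc s)
  have "(unicrit d c ^^ (k * Suc s)) 0 = (unicrit d c ^^ (k * s)) ((unicrit d c ^^ k) 0)"
    by (simp only: mult_Suc_right add.commute[of k] funpow_add o_apply)
  also have "\<dots> = ((unicrit d c ^^ k) 0) ^ (d ^ (k * s)) + (unicrit d c ^^ (k * s)) 0"
    by (rule funpow_unicrit)
  finally show ?case using Suc by (simp add: add.commute)
qed simp

text \<open>The case \<open>k = 1\<close>, where the first iterate of 0 is \<open>c\<close> because
  d > 0. Parameters with a prescribed iterate of 0 thereby become roots of a polynomial.\<close>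

lemma funpow_unicrit_eq_poly:
  "(unicrit d c ^^ n) (0 :: 'b) = poly (\<Sum>i<n. monom 1 (d ^ i)) c"
  using funpow_unicrit_mult[of 1 n c] d_gt_1
  by (simp add: poly_sum poly_monom unicrit_def power_0_left)

end

text \<open>In characteristic p only the linear term of the sum survives differentiation, so
  \<open>pderiv P\<close> is 1, all roots are simple, and their number is the degree.\<close>

lemma card_unicrit_parameters:
  fixes \<gamma> :: "'b::alg_closed_field"
  assumes "frobenius_power TYPE('b) d l" and n: "n > 0"
  shows "card {c. (unicrit d c ^^ n) 0 = \<gamma>} \<ge> d ^ (n - 1)"
proof -
  interpret frobenius_power d l "TYPE('b)" by fact
  define P where "P = (\<Sum>i<n. monom (1 :: 'b) (d ^ i)) - [:\<gamma>:]"
  \<comment> \<open>The exponents \<open>d ^ i\<close> are distinct as d > 1, and the constant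
    \<open>\<gamma>\<close> does not interfere because \<open>d ^ (n - 1)\<close> is
    positive.\<close>
  have "coeff P (d ^ (n - 1)) = (\<Sum>i<n. if i = n - 1 then 1 else 0)"
    using d_gt_1
    by (auto simp: P_def coeff_sum monom_0[symmetric] intro!: sum.cong)
  also have "\<dots> = 1" using n by simp
  finally have coeff: "coeff P (d ^ (n - 1)) \<noteq> 0" by simp
  have d0: "(of_nat d :: 'b) = 0"
    using l_pos by (simp add: d_eq)
  have "pderiv (monom (1 :: 'b) (d ^ i)) = (if i = 0 then 1 else 0)" for i
    using d0 by (simp add: pderiv_monom monom_0)
  then have "pderiv P = (\<Sum>i<n. if i = 0 then 1 else 0)"
    using sum_comp_morphism[OF pderiv_0 pderiv_add, of "\<lambda>i. monom (1 :: 'b) (d ^ i)" "{..<n}"]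
    by (simp add: P_def pderiv_diff pderiv_pCons o_def)
  also have "\<dots> = 1" using n by simp
  finally have "card {x. poly P x = 0} = degree P"
    using coeff by (intro card_roots_separable) auto
  moreover have "{x. poly P x = 0} = {c. (unicrit d c ^^ n) 0 = \<gamma>}"
    by (auto simp: P_def funpow_unicrit_eq_poly)
  ultimately show ?thesis
    using le_degree[OF coeff] by simp
qed

section \<open>Visits of orbits to a finite additive subgroup stable under z^d\<close>

locale frobenius_subgroup = frobenius_power d l ty
  for d l and ty :: "'b::field itself" +
  fixes G :: "'b set"
  assumes fin: "finite G"
    and zero_mem: "0 \<in> G"
    and diff_mem: "\<lbrakk>x \<in> G; y \<in> G\<rbrakk> \<Longrightarrow> x - y \<in> G"
    and power_mem: "x \<in> G \<Longrightarrow> x ^ d \<in> G"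
begin

lemma add_mem: "\<lbrakk>x \<in> G; y \<in> G\<rbrakk> \<Longrightarrow> x + y \<in> G"
  using diff_mem[of x "0 - y"] diff_mem[OF zero_mem, of y] by simp

lemma frob_mem: "x \<in> G \<Longrightarrow> x ^ (d ^ n) \<in> G"
proof (induction n)
  case (Suc n)
  then show ?case using power_mem[of "x ^ d ^ n"] by (simp add: mult.commute flip: power_mult)
qed simp

lemma sum_mem: "(\<And>i. i \<in> A \<Longrightarrow> h i \<in> G) \<Longrightarrow> sum h A \<in> G"
  by (induction A rule: infinite_finite_induct) (auto intro: zero_mem add_mem)

text \<open>The map \<open>unicrit d 0\<close> is z^d itself. It is injective and keeps the orbit of
  \<open>x\<close> in the finite set \<open>G\<close>, so the orbit is purely periodic.\<close>

lemma frobenius_periodic: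
  assumes "x \<in> G"
  obtains N where "N > 0" "x ^ (d ^ N) = x"
proof -
  have pow: "(unicrit d 0 ^^ n) x = x ^ (d ^ n)" for n
    by (induction n)
      (simp_all add: funpow_Suc_unicrit mult.commute del: funpow.simps(2) flip: power_mult)
  have "{y. \<exists>n. y = (unicrit d 0 ^^ n) x} \<subseteq> G"
    using assms frob_mem pow by auto
  then show ?thesis
    using funpow_inj_finite[OF inj_unicrit] that pow fin by (metis finite_subset)
qed

lemma funpow_mult_mem:
  "(unicrit d c ^^ k) 0 \<in> G \<Longrightarrow> (unicrit d c ^^ (k * s)) 0 \<in> G"
  by (auto simp: funpow_unicrit_mult intro: sum_mem frob_mem)

text \<open>The same argument for the \<open>k\<close>-th iterate. The factor \<open>j\<close> lets
  later proofs add enough periods to keep a difference of times positive.\<close>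

lemma zero_periodic:
  assumes "(unicrit d c ^^ k) 0 \<in> G"
  obtains N where "N > 0" "\<And>j. (unicrit d c ^^ (k * N * j)) 0 = 0"
proof -
  let ?g = "unicrit d c ^^ k"
  have pow: "?g ^^ n = unicrit d c ^^ (k * n)" for n
    by (simp add: funpow_mult mult.commute)
  have "{y. \<exists>n. y = (?g ^^ n) 0} \<subseteq> G"
    using funpow_mult_mem[OF assms] by (auto simp: pow)
  moreover have "inj ?g"
    using inj_fn[OF inj_unicrit] .
  ultimately obtain N where N: "N > 0" "(?g ^^ N) 0 = 0"
    using funpow_inj_finite fin by (metis finite_subset)
  have "(unicrit d c ^^ (k * N * j)) 0 = 0" for j
    using N(2) unfolding pow funpow_unicrit_mult[of "k * N"] using d_gt_1
    by (simp add: power_0_left)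
  with N(1) show ?thesis using that by blast
qed

lemma collision_if_visits:
  assumes k: "k > 0" "(unicrit d c ^^ k) 0 \<in> G" and s: "s\<^sub>1 > 0" "s\<^sub>2 > 0"
  shows "\<exists>n>0. (unicrit d c ^^ n) ((unicrit d c ^^ (k * s\<^sub>1)) 0) = (unicrit d c ^^ (k * s\<^sub>2)) 0"
proof -
  let ?f = "unicrit d c"
  obtain N where N: "N > 0" "\<And>j. (?f ^^ (k * N * j)) 0 = 0"
    using zero_periodic[OF k(2)] by blast
  \<comment> \<open>The time from the first point to the second is
    \<open>k * s\<^sub>2 - k * s\<^sub>1\<close>, possibly negative; adding \<open>s\<^sub>1\<close>
    periods of 0 makes it positive.\<close>
  define n where "n = k * s\<^sub>2 + k * N * s\<^sub>1 - k * s\<^sub>1"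
  have "k * s\<^sub>1 \<le> k * N * s\<^sub>1" using N(1) by simp
  moreover have "k * s\<^sub>2 > 0" using k s by simp
  ultimately have n: "n > 0" "n + k * s\<^sub>1 = k * s\<^sub>2 + k * N * s\<^sub>1"
    unfolding n_def by linarith+
  have "(?f ^^ n) ((?f ^^ (k * s\<^sub>1)) 0) = (?f ^^ (n + k * s\<^sub>1)) 0"
    by (simp add: funpow_add)
  also have "\<dots> = (?f ^^ (k * s\<^sub>2)) 0"
    unfolding n(2) by (simp add: funpow_add N(2))
  finally show ?thesis using n(1) by blast
qed

lemma visits_if_collision:
  assumes \<delta>: "\<delta>\<^sub>1 \<in> G" "\<delta>\<^sub>2 \<in> G" and m: "m > 0"
    and coll: "(unicrit d c ^^ m) 0 = \<delta>\<^sub>2" "(unicrit d c ^^ n) \<delta>\<^sub>1 = \<delta>\<^sub>2"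
  obtains k s\<^sub>1 s\<^sub>2 where "k > 0" "s\<^sub>1 > 0" "s\<^sub>2 > 0" "(unicrit d c ^^ k) 0 \<in> G"
    "(unicrit d c ^^ (k * s\<^sub>1)) 0 = \<delta>\<^sub>1" "(unicrit d c ^^ (k * s\<^sub>2)) 0 = \<delta>\<^sub>2"
proof -
  let ?f = "unicrit d c"
  define k where "k = (LEAST k. k > 0 \<and> (?f ^^ k) 0 \<in> G)"
  have "m > 0 \<and> (?f ^^ m) 0 \<in> G" using m coll \<delta> by simp
  then have k: "k > 0" "(?f ^^ k) 0 \<in> G"
    unfolding k_def by (metis (mono_tags, lifting) LeastI)+
  have k_le: "k \<le> r" if "r > 0" "(?f ^^ r) 0 \<in> G" for r
    unfolding k_def using that by (intro Least_le) simp
  have dvd: "k dvd t" if t: "(?f ^^ t) 0 \<in> G" for t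
  proof (rule ccontr)
    assume "\<not> k dvd t"
    \<comment> \<open>Division with remainder: the iterate of 0 at time \<open>t mod k\<close> would
      be a difference of two elements of \<open>G\<close>, against the minimality of
      \<open>k\<close>.\<close>
    then have r: "t mod k > 0" by (simp add: mod_greater_zero_iff_not_dvd)
    let ?x = "(?f ^^ (k * (t div k))) 0"
    have "(?f ^^ t) 0 = (?f ^^ (t mod k + k * (t div k))) 0" by simp
    also have "\<dots> = (?f ^^ (t mod k)) ?x" unfolding funpow_add by simp
    also have "\<dots> = ?x ^ (d ^ (t mod k)) + (?f ^^ (t mod k)) 0" by (rule funpow_unicrit)
    finally have "(?f ^^ (t mod k)) 0 = (?f ^^ t) 0 - ?x ^ (d ^ (t mod k))" by simp
    then have "(?f ^^ (t mod k)) 0 \<in> G"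
      using t funpow_mult_mem[OF k(2)] by (simp add: diff_mem frob_mem)
    then have "k \<le> t mod k" using k_le r by blast
    moreover have "t mod k < k" using k(1) by simp
    ultimately show False by simp
  qed
  obtain N where N: "N > 0" "\<And>j. (?f ^^ (k * N * j)) 0 = 0"
    using zero_periodic[OF k(2)] by blast
  \<comment> \<open>The time at which 0 reaches \<open>\<delta>\<^sub>1\<close>: after
    \<open>n\<close> more steps both are at \<open>\<delta>\<^sub>2\<close>, and injectivity cancels
    these steps. Adding \<open>n\<close> periods keeps \<open>m - n\<close> positive.\<close>
  define t where "t = m + k * N * n - n"
  have "n \<le> k * N * n" using N(1) k(1) by simp
  then have t: "t > 0" "n + t = m + k * N * n"
    using m unfolding t_def by linarith+
  have "(?f ^^ n) ((?f ^^ t) 0) = (?f ^^ (n + t)) 0" by (simp add: funpow_add)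
  also have "\<dots> = (?f ^^ n) \<delta>\<^sub>1"
    unfolding t(2) by (simp add: funpow_add N(2) coll)
  finally have t1: "(?f ^^ t) 0 = \<delta>\<^sub>1"
    using inj_fn[OF inj_unicrit, of n c] by (simp add: inj_eq)
  obtain s\<^sub>1 s\<^sub>2 where s: "t = k * s\<^sub>1" "m = k * s\<^sub>2"
    using dvd[of t] dvd[of m] t1 coll \<delta> by (auto elim!: dvdE)
  show ?thesis
    by (rule that[of k s\<^sub>1 s\<^sub>2]) (use k s t m t1 coll in auto)
qed

end

section \<open>Infinitely many parameters from one solution\<close>

lemma infinite_collisions:
  fixes \<gamma> :: "'b::alg_closed_field"
  assumes "frobenius_subgroup d l G"
    and \<gamma>: "\<gamma> \<in> G" and pos: "k > 0" "s\<^sub>1 > 0" "s\<^sub>2 > 0"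
    and \<delta>\<^sub>1: "\<delta>\<^sub>1 = (\<Sum>i<s\<^sub>1. \<gamma> ^ (d ^ (k * i)))" and \<delta>\<^sub>2: "\<delta>\<^sub>2 = (\<Sum>i<s\<^sub>2. \<gamma> ^ (d ^ (k * i)))"
  shows "infinite {c. \<exists>m>0. \<exists>n>0. (unicrit d c ^^ m) 0 = \<delta>\<^sub>2 \<and> (unicrit d c ^^ n) \<delta>\<^sub>1 = \<delta>\<^sub>2}"
    (is "infinite ?C")
proof
  interpret frobenius_subgroup d l "TYPE('b)" G by fact
  assume "finite ?C"
  obtain N where N: "N > 0" "\<gamma> ^ (d ^ N) = \<gamma>"
    using frobenius_periodic[OF \<gamma>] by blast
  have period: "\<gamma> ^ (d ^ (N * j)) = \<gamma>" for j
  proof (induction j)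
    case (Suc j)
    have "\<gamma> ^ (d ^ (N * Suc j)) = (\<gamma> ^ (d ^ N)) ^ (d ^ (N * j))"
      by (simp add: power_add flip: power_mult)
    then show ?case using Suc N by simp
  qed simp
  \<comment> \<open>Adding \<open>N * j\<close> to \<open>k\<close> leaves the sums unchanged, while
    the number of admissible parameters, at least \<open>d ^ (k' - 1)\<close>, outgrows the supposed
    size of \<open>?C\<close>.\<close>
  define j where "j = card ?C + 1"
  define k' where "k' = k + N * j"
  have k': "k' > 0" using pos by (simp add: k'_def)
  have frob: "\<gamma> ^ (d ^ (k' * i)) = \<gamma> ^ (d ^ (k * i))" for i
  proof -
    have "\<gamma> ^ (d ^ (k' * i)) = (\<gamma> ^ (d ^ (N * (j * i)))) ^ (d ^ (k * i))"
      by (simp add: k'_def algebra_simps power_add flip: power_mult)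
    then show ?thesis by (simp only: period)
  qed
  have sub: "{c. (unicrit d c ^^ k') 0 = \<gamma>} \<subseteq> ?C"
  proof clarify
    fix c
    assume c: "\<gamma> = (unicrit d c ^^ k') 0"
    have "(unicrit d c ^^ (k' * s\<^sub>1)) 0 = \<delta>\<^sub>1" "(unicrit d c ^^ (k' * s\<^sub>2)) 0 = \<delta>\<^sub>2"
      by (simp_all add: funpow_unicrit_mult \<delta>\<^sub>1 \<delta>\<^sub>2 frob flip: c)
    moreover have "k' * s\<^sub>2 > 0" using k' pos by simp
    ultimately show "\<exists>m>0. \<exists>n>0. (unicrit d c ^^ m) 0 = \<delta>\<^sub>2 \<and> (unicrit d c ^^ n) \<delta>\<^sub>1 = \<delta>\<^sub>2"
      using collision_if_visits[of k' c s\<^sub>1 s\<^sub>2] c \<gamma> k' pos by metis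
  qed
  have "card ?C < j" by (simp add: j_def)
  also have "j \<le> N * j" using N(1) by simp
  also have "\<dots> \<le> k' - 1" using pos by (simp add: k'_def)
  also have "\<dots> < d ^ (k' - 1)" using d_gt_1 by (simp add: power_gt_expt)
  also have "\<dots> \<le> card {c. (unicrit d c ^^ k') 0 = \<gamma>}"
    using card_unicrit_parameters[OF frobenius_power_axioms k'] .
  also have "\<dots> \<le> card ?C" using card_mono[OF \<open>finite ?C\<close> sub] .
  finally show False by simp
qed

section \<open>Transfer between the field and its algebraic closure\<close>

lemma system_solution_iff:
  assumes "d = p ^ l"
  shows "system_solution p l F \<delta>\<^sub>1 \<delta>\<^sub>2 \<gamma> k s\<^sub>1 s\<^sub>2 \<longleftrightarrow>
    \<gamma> \<in> F - {0} \<and> k > 0 \<and> s\<^sub>1 > 0 \<and> s\<^sub>2 > 0 \<and>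
    to_ac \<delta>\<^sub>1 = (\<Sum>i<s\<^sub>1. to_ac \<gamma> ^ (d ^ (k * i))) \<and>
    to_ac \<delta>\<^sub>2 = (\<Sum>i<s\<^sub>2. to_ac \<gamma> ^ (d ^ (k * i)))"
proof -
  \<comment> \<open>Positivity matters: for \<open>s = 0\<close> the truncated \<open>s - 1\<close>
    would leave the index 0.\<close>
  have range: "{0..s - 1} = {..<s}" if "s > 0" for s :: nat
    using that by auto
  have exponent: "p ^ (i * k * l) = d ^ (k * i)" for i
    by (simp add: assms ac_simps flip: power_mult)
  have "\<delta> = (\<Sum>i = 0..s - 1. \<gamma> ^ (p ^ (i * k * l))) \<longleftrightarrow>
      to_ac \<delta> = (\<Sum>i<s. to_ac \<gamma> ^ (d ^ (k * i)))" if "s > 0" for \<delta> s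
    unfolding range[OF that] exponent
    by (simp flip: to_ac_power to_ac_sum)
  then show ?thesis unfolding system_solution_def by blast
qed

theorem theorem2p2:
  fixes \<alpha>\<^sub>1 \<alpha>\<^sub>2 \<beta> \<delta>\<^sub>1 \<delta>\<^sub>2 :: "'a::field"
    and p l d :: nat
    and F :: "'a set"
  assumes "prime p" and "CHAR('a) = p"
    and "\<alpha>\<^sub>1 \<noteq> \<alpha>\<^sub>2"
    and "l > 0" and "d = p ^ l"
    and "\<delta>\<^sub>1 = \<alpha>\<^sub>2 - \<alpha>\<^sub>1" and "\<delta>\<^sub>2 = \<beta> - \<alpha>\<^sub>1"
    and "subfield F (ring_of_type_algebra :: 'a ring)" and "finite F"
    and "\<delta>\<^sub>1 \<in> F - {0}" and "\<delta>\<^sub>2 \<in> F"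
  shows "((\<exists>\<gamma> k s\<^sub>1 s\<^sub>2. system_solution p l F \<delta>\<^sub>1 \<delta>\<^sub>2 \<gamma> k s\<^sub>1 s\<^sub>2) \<longrightarrow>
            infinite (collision_set d \<alpha>\<^sub>1 \<alpha>\<^sub>2 \<beta>)) \<and>
         ((\<nexists>\<gamma> k s\<^sub>1 s\<^sub>2. system_solution p l F \<delta>\<^sub>1 \<delta>\<^sub>2 \<gamma> k s\<^sub>1 s\<^sub>2) \<longrightarrow>
            collision_set d \<alpha>\<^sub>1 \<alpha>\<^sub>2 \<beta> = {})"
proof -
  let ?G = "to_ac ` F"
  let ?sys = "system_solution p l F \<delta>\<^sub>1 \<delta>\<^sub>2"
  \<comment> \<open>The collision parameters after translation, with starting points 0 and
    \<open>\<delta>\<^sub>1\<close> and target \<open>\<delta>\<^sub>2\<close>.\<close>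
  define C where "C = {c. \<exists>m>0. \<exists>n>0. (unicrit d c ^^ m) 0 = to_ac \<delta>\<^sub>2 \<and>
    (unicrit d c ^^ n) (to_ac \<delta>\<^sub>1) = to_ac \<delta>\<^sub>2}"
  note F = subcringE[OF subfieldE(2)[OF \<open>subfield F ring_of_type_algebra\<close>]]
  have zero: "0 \<in> F" and one: "1 \<in> F"
    using F(2,3) by (simp_all add: ring_of_type_algebra_def)
  have times: "x * y \<in> F" if "x \<in> F" "y \<in> F" for x y
    using F(6)[OF that] by (simp add: ring_of_type_algebra_def)
  have diff: "x - y \<in> F" if "x \<in> F" "y \<in> F" for x y
  proof -
    let ?R = "ring_of_type_algebra :: 'a ring"
    interpret R: field ?R by (rule field_from_type_algebra)
    have "y + (\<ominus>\<^bsub>?R\<^esub> y) = 0"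
      using R.r_neg[of y] by (simp add: ring_of_type_algebra_def)
    then have "\<ominus>\<^bsub>?R\<^esub> y = - y" by (rule minus_unique[symmetric])
    then have "- y \<in> F"
      using F(5)[OF \<open>y \<in> F\<close>] by simp
    then show ?thesis
      using F(7)[OF \<open>x \<in> F\<close>, of "- y"]
      by (simp add: ring_of_type_algebra_def)
  qed
  have pow: "x ^ n \<in> F" if "x \<in> F" for x n
    by (induction n) (auto intro: one times that)
  interpret frobenius_subgroup d l "TYPE('a alg_closure)" ?G
  proof unfold_locales
    show "x - y \<in> ?G" if "x \<in> ?G" "y \<in> ?G" for x y
      using that diff by (auto simp flip: to_ac_diff)
    show "x ^ d \<in> ?G" if "x \<in> ?G" for x
      using that pow by (auto simp flip: to_ac_power)
  qed (use assms zero in \<open>auto simp: image_iff\<close>)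
  have \<delta>: "to_ac \<delta>\<^sub>1 \<in> ?G" "to_ac \<delta>\<^sub>2 \<in> ?G" using assms(10,11) by blast+
  let ?a = "to_ac \<alpha>\<^sub>1"
  have conj: "(unicrit d lam ^^ n) (to_ac x) = to_ac \<beta> \<longleftrightarrow>
      (unicrit d (lam + ?a ^ d - ?a) ^^ n) (to_ac (x - \<alpha>\<^sub>1)) = to_ac \<delta>\<^sub>2" for lam n x
    unfolding funpow_unicrit_conj[of n lam "to_ac x" ?a] assms(7) by (simp add: eq_diff_eq)
  have "lam \<in> collision_set d \<alpha>\<^sub>1 \<alpha>\<^sub>2 \<beta> \<longleftrightarrow> lam + ?a ^ d - ?a \<in> C" for lam
    unfolding collision_set_def C_def mem_Collect_eq conj assms(6) diff_self to_ac_0 by blast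
  \<comment> \<open>The parameter shift is a bijection, so infinitude and emptiness carry over from
    \<open>C\<close>.\<close>
  then have eq: "collision_set d \<alpha>\<^sub>1 \<alpha>\<^sub>2 \<beta> = (\<lambda>lam. lam + (?a ^ d - ?a)) -` C"
    by (auto simp: add_diff_eq)
  have "infinite (collision_set d \<alpha>\<^sub>1 \<alpha>\<^sub>2 \<beta>)" if "?sys \<gamma> k s\<^sub>1 s\<^sub>2" for \<gamma> k s\<^sub>1 s\<^sub>2
  proof -
    have "infinite C"
      unfolding C_def using that[unfolded system_solution_iff[OF \<open>d = p ^ l\<close>]]
      by (intro infinite_collisions[OF frobenius_subgroup_axioms, of "to_ac \<gamma>" k s\<^sub>1 s\<^sub>2]) auto
    moreover have "surj (\<lambda>lam. lam + (?a ^ d - ?a))"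
      by (metis diff_add_cancel surjI)
    ultimately show ?thesis
      unfolding eq using finite_vimageD by blast
  qed
  moreover have "\<exists>\<gamma> k s\<^sub>1 s\<^sub>2. ?sys \<gamma> k s\<^sub>1 s\<^sub>2" if c: "c \<in> C" for c
  proof -
    obtain m n where mn: "m > 0" "(unicrit d c ^^ m) 0 = to_ac \<delta>\<^sub>2"
        "(unicrit d c ^^ n) (to_ac \<delta>\<^sub>1) = to_ac \<delta>\<^sub>2"
      using c unfolding C_def by blast
    obtain k s\<^sub>1 s\<^sub>2 where pos: "k > 0" "s\<^sub>1 > 0" "s\<^sub>2 > 0"
      and visit: "(unicrit d c ^^ k) 0 \<in> ?G"
        "(unicrit d c ^^ (k * s\<^sub>1)) 0 = to_ac \<delta>\<^sub>1" "(unicrit d c ^^ (k * s\<^sub>2)) 0 = to_ac \<delta>\<^sub>2"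
      using visits_if_collision[OF \<delta> mn] by blast
    obtain \<gamma> where \<gamma>: "\<gamma> \<in> F" "(unicrit d c ^^ k) 0 = to_ac \<gamma>"
      using visit(1) by auto
    have sums: "to_ac \<delta>\<^sub>1 = (\<Sum>i<s\<^sub>1. to_ac \<gamma> ^ (d ^ (k * i)))"
        "to_ac \<delta>\<^sub>2 = (\<Sum>i<s\<^sub>2. to_ac \<gamma> ^ (d ^ (k * i)))"
      using visit(2,3) by (simp_all add: funpow_unicrit_mult \<gamma>)
    \<comment> \<open>With \<open>\<gamma> = 0\<close> every sum of the system would vanish,
      contradicting that \<open>\<delta>\<^sub>1\<close> is nonzero.\<close>
    have "to_ac \<delta>\<^sub>1 \<noteq> 0" using assms by simp
    then have "\<gamma> \<noteq> 0" using sums(1) d_gt_1 by (auto simp: power_0_left)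
    then have "?sys \<gamma> k s\<^sub>1 s\<^sub>2"
      using \<gamma>(1) pos sums by (simp add: system_solution_iff[OF \<open>d = p ^ l\<close>])
    then show ?thesis by blast
  qed
  ultimately show ?thesis
    unfolding eq by blast
qed

end
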